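(* For every integer $n \geq 1$, $h_n = \lceil \frac{n}{2} \rceil$. That is, the minimum number of lines in $\mathbb{R}^2$ such that every cell of the $n\times n$ chessboard $Q_n$ has nonempty intersection with at least one of the lines equals $\lceil n/2 \rceil$.
   Context: For $n \geq 1$, $Q_n$ is the $n\times n$ chessboard in $[-1,1]^2$ whose cells are the closed squares $c_{ij} = \left[-1+(i-1)\frac 2n, -1+i\frac 2n\right] \times \left[-1+(j-1)\frac 2n, -1+j\frac 2n\right]$ for $i,j \in \{1,\dots,n\}$. A line $\ell$ hits (intersects) a cell $c_{ij}$ if $\ell \cap c_{ij} \neq \emptyset$. $h_n$ denotes the minimum number of lines needed to hit every cell of $Q_n$. *)

theory Defs
  imports "HOL-Analysis.Analysis"
begin

definition line :: "(real \<times> real) set \<Rightarrow> bool" where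
  "line l \<longleftrightarrow> affine l \<and> aff_dim l = 1"

definition cell :: "nat \<Rightarrow> nat \<Rightarrow> nat \<Rightarrow> (real \<times> real) set" where
  "cell n i j =
     {-1 + (real i - 1) * (2 / real n) .. -1 + real i * (2 / real n)} \<times>
     {-1 + (real j - 1) * (2 / real n) .. -1 + real j * (2 / real n)}"

definition hits :: "(real \<times> real) set \<Rightarrow> (real \<times> real) set \<Rightarrow> bool" where
  "hits l c \<longleftrightarrow> l \<inter> c \<noteq> {}"

definition hits_board :: "nat \<Rightarrow> (real \<times> real) set set \<Rightarrow> bool" where
  "hits_board n L \<longleftrightarrow> (\<forall>i\<in>{1..n}. \<forall>j\<in>{1..n}. \<exists>l\<in>L. hits l (cell n i j))"

(* The n horizontal lines through the cell rows hit every cell, so the LEAST is attained. *)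
definition h :: "nat \<Rightarrow> nat" where
  "h n = (LEAST k. \<exists>L. finite L \<and> card L = k \<and> (\<forall>l\<in>L. line l) \<and> hits_board n L)"

end

theory Submission imports Defs begin

text \<open>
  The upper bound uses the horizontal lines between rows \<open>2i - 1\<close> and \<open>2i\<close>. The lower bound is
  Ball's plank theorem for the sup-norm square, for planks of equal half-width \<open>w\<close>: if each line is
  written \<open>a x + b y = m\<close> with \<open>\<bar>a\<bar> + \<bar>b\<bar> = 1\<close> and there are fewer than \<open>1 / w\<close> of them, some
  point of \<open>[-1,1]\<^sup>2\<close> is at distance at least \<open>w\<close> from all of them; for \<open>w > 2/n\<close> no
  line then meets the cell of that point. The point is a signed sum of the vectors
  \<open>w (a, r b) / (a\<^sup>2 + r b\<^sup>2)\<close>, with signs from Bang's lemma for the inner product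
  \<open>x x' + r y y'\<close>. Such sums stay in the square for a suitable \<open>r\<close>: the quantities
  \<open>F = \<bar>a\<bar> / (a\<^sup>2 + r b\<^sup>2)\<close> and \<open>G = r \<bar>b\<bar> / (a\<^sup>2 + r b\<^sup>2)\<close> satisfy \<open>r F + G \<le> 1 + r\<close>,
  and the intermediate value theorem gives an \<open>r\<close> that balances their sums.
\<close>

section \<open>Bang's lemma on choosing signs\<close>

lemma Bang_signs:
  fixes v :: "'i \<Rightarrow> 'a::real_inner" and \<mu> :: "'i \<Rightarrow> real"
  assumes "finite I"
  obtains \<epsilon> :: "'i \<Rightarrow> real"
  where "\<And>i. i \<in> I \<Longrightarrow> \<bar>\<epsilon> i\<bar> = 1"
    and "\<And>i. i \<in> I \<Longrightarrow> (norm (v i))\<^sup>2 \<le> \<bar>v i \<bullet> (\<Sum>j\<in>I. \<epsilon> j *\<^sub>R v j) - \<mu> i\<bar>"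
proof -
  \<comment> \<open>Extensionality outside \<open>I\<close> keeps the set of sign patterns finite,
    so that a maximiser exists.\<close>
  define E where "E = PiE I (\<lambda>_. {-1, 1::real})"
  define S where "S = (\<lambda>\<epsilon>. \<Sum>j\<in>I. \<epsilon> j *\<^sub>R v j)"
  \<comment> \<open>A maximiser of \<open>P\<close> has the required signs: flipping the sign at
    \<open>i\<close> changes \<open>P\<close> by 4 times \<open>v i \<bullet> v i - \<epsilon> i *
    (v i \<bullet> S \<epsilon> - \<mu> i)\<close>, and maximality makes this at most 0.\<close>
  define P where "P = (\<lambda>\<epsilon>. S \<epsilon> \<bullet> S \<epsilon> - 2 * (\<Sum>j\<in>I. \<epsilon> j * \<mu> j))"
  have "finite E" "E \<noteq> {}"
    unfolding E_def using assms by (auto intro: finite_PiE simp: PiE_eq_empty_iff)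
  then have "Max (P ` E) \<in> P ` E" "\<And>\<delta>. \<delta> \<in> E \<Longrightarrow> P \<delta> \<le> Max (P ` E)"
    by auto
  then obtain \<epsilon> where \<epsilon>: "\<epsilon> \<in> E" and max: "\<And>\<delta>. \<delta> \<in> E \<Longrightarrow> P \<delta> \<le> P \<epsilon>"
    by force
  have abs1: "\<bar>\<epsilon> i\<bar> = 1" if "i \<in> I" for i
    using PiE_mem[OF \<epsilon>[unfolded E_def] that] by auto
  have "(norm (v i))\<^sup>2 \<le> \<bar>v i \<bullet> S \<epsilon> - \<mu> i\<bar>" if i: "i \<in> I" for i
  proof -
    let ?\<delta> = "\<epsilon>(i := - \<epsilon> i)"
    have "?\<delta> \<in> E"
      using \<epsilon> i unfolding E_def PiE_iff extensional_def by auto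
    then have le: "P ?\<delta> \<le> P \<epsilon>"
      by (rule max)
    have "(\<Sum>j\<in>I - {i}. ?\<delta> j *\<^sub>R v j) = (\<Sum>j\<in>I - {i}. \<epsilon> j *\<^sub>R v j)"
      by (rule sum.cong) auto
    then have "S ?\<delta> = - (\<epsilon> i *\<^sub>R v i) + (\<Sum>j\<in>I - {i}. \<epsilon> j *\<^sub>R v j)"
      unfolding S_def by (subst sum.remove[OF assms i]) simp
    moreover have "S \<epsilon> = \<epsilon> i *\<^sub>R v i + (\<Sum>j\<in>I - {i}. \<epsilon> j *\<^sub>R v j)"
      unfolding S_def by (rule sum.remove[OF assms i])
    moreover have "(2 * \<epsilon> i) *\<^sub>R v i = \<epsilon> i *\<^sub>R v i + \<epsilon> i *\<^sub>R v i"
      by (simp flip: scaleR_add_left)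
    ultimately have S: "S ?\<delta> = S \<epsilon> - (2 * \<epsilon> i) *\<^sub>R v i"
      by simp
    have "(\<Sum>j\<in>I - {i}. ?\<delta> j * \<mu> j) = (\<Sum>j\<in>I - {i}. \<epsilon> j * \<mu> j)"
      by (rule sum.cong) auto
    then have M: "(\<Sum>j\<in>I. ?\<delta> j * \<mu> j) = (\<Sum>j\<in>I. \<epsilon> j * \<mu> j) - 2 * \<epsilon> i * \<mu> i"
      by (simp add: sum.remove[OF assms i])
    have "\<epsilon> i * \<epsilon> i = 1"
      using abs1[OF i] by (metis abs_mult_self_eq mult_1)
    then have "(2 * \<epsilon> i) *\<^sub>R v i \<bullet> (2 * \<epsilon> i) *\<^sub>R v i = 4 * (v i \<bullet> v i)"
      by (simp add: algebra_simps)
    moreover have "S ?\<delta> \<bullet> S ?\<delta> = S \<epsilon> \<bullet> S \<epsilon> - 4 * \<epsilon> i * (v i \<bullet> S \<epsilon>)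
        + (2 * \<epsilon> i) *\<^sub>R v i \<bullet> (2 * \<epsilon> i) *\<^sub>R v i"
      unfolding S by (simp add: inner_diff_left inner_diff_right inner_commute algebra_simps)
    ultimately have "S ?\<delta> \<bullet> S ?\<delta> = S \<epsilon> \<bullet> S \<epsilon> - 4 * \<epsilon> i * (v i \<bullet> S \<epsilon>) + 4 * (v i \<bullet> v i)"
      by simp
    with le M have "v i \<bullet> v i \<le> \<epsilon> i * (v i \<bullet> S \<epsilon> - \<mu> i)"
      unfolding P_def by (simp add: algebra_simps)
    also have "\<dots> \<le> \<bar>v i \<bullet> S \<epsilon> - \<mu> i\<bar>"
      using abs1[OF i] abs_ge_self[of "\<epsilon> i * (v i \<bullet> S \<epsilon> - \<mu> i)"] by (simp add: abs_mult)
    finally show ?thesis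
      by (simp add: power2_norm_eq_inner)
  qed
  with abs1 that show thesis
    unfolding S_def by blast
qed

section \<open>Choosing the weight of the inner product\<close>

lemma weighted_square_pos:
  fixes a b r :: real
  assumes "\<bar>a\<bar> + \<bar>b\<bar> = 1" "0 < r"
  shows "0 < a\<^sup>2 + r * b\<^sup>2"
proof (cases "a = 0")
  case True
  with assms show ?thesis by auto
next
  case False
  with assms show ?thesis by (simp add: add_pos_nonneg)
qed

text \<open>The difference of the two sides is the square of
  \<open>\<bar>a\<bar> - r * \<bar>b\<bar>\<close>. For positive \<open>r\<close> this is
  Cauchy-Schwarz for \<open>(\<bar>a\<bar>, sqrt r * \<bar>b\<bar>)\<close> and
  \<open>(1, 1 / sqrt r)\<close>.\<close>

lemma weighted_square_ge:
  fixes a b r :: real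
  assumes "\<bar>a\<bar> + \<bar>b\<bar> = 1"
  shows "r \<le> (1 + r) * (a\<^sup>2 + r * b\<^sup>2)"
proof -
  have b: "\<bar>b\<bar> = 1 - \<bar>a\<bar>"
    using assms by simp
  have "(1 + r) * (\<bar>a\<bar>\<^sup>2 + r * \<bar>b\<bar>\<^sup>2) - r = (\<bar>a\<bar> - r * \<bar>b\<bar>)\<^sup>2"
    unfolding b by (simp add: power2_eq_square algebra_simps)
  then have "0 \<le> (1 + r) * (\<bar>a\<bar>\<^sup>2 + r * \<bar>b\<bar>\<^sup>2) - r"
    by simp
  then show ?thesis
    by simp
qed

text \<open>The bound on \<open>r * F r + G r\<close> controls only a weighted mean of the two sums.
  It bounds both of them where they are equal; if they do not cross, the larger one is bounded at an
  extreme value of \<open>r\<close>, at the cost of a factor that the slack in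
  \<open>card I * w < 1\<close> absorbs.\<close>

lemma balanced_scaling:
  fixes a b :: "'i \<Rightarrow> real" and w :: real
  assumes norm: "\<And>k. k \<in> I \<Longrightarrow> \<bar>a k\<bar> + \<bar>b k\<bar> = 1"
    and w: "0 \<le> w" "real (card I) * w < 1"
  obtains r where "0 < r"
    and "w * (\<Sum>k\<in>I. \<bar>a k\<bar> / ((a k)\<^sup>2 + r * (b k)\<^sup>2)) \<le> 1"
    and "w * (\<Sum>k\<in>I. r * \<bar>b k\<bar> / ((a k)\<^sup>2 + r * (b k)\<^sup>2)) \<le> 1"
proof -
  define F where "F = (\<lambda>r. \<Sum>k\<in>I. \<bar>a k\<bar> / ((a k)\<^sup>2 + r * (b k)\<^sup>2))"
  define G where "G = (\<lambda>r. \<Sum>k\<in>I. r * \<bar>b k\<bar> / ((a k)\<^sup>2 + r * (b k)\<^sup>2))"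
  define c where "c = real (card I)"
  have c: "0 \<le> c" "c * w < 1"
    using w by (auto simp: c_def)
  have FG: "r * F r + G r \<le> c * (1 + r)" if "0 < r" for r
  proof -
    have "r * F r + G r
        = (\<Sum>k\<in>I. r * (\<bar>a k\<bar> / ((a k)\<^sup>2 + r * (b k)\<^sup>2)) + r * \<bar>b k\<bar> / ((a k)\<^sup>2 + r * (b k)\<^sup>2))"
      by (simp add: F_def G_def sum.distrib sum_distrib_left)
    also have "\<dots> \<le> (\<Sum>k\<in>I. 1 + r)"
    proof (rule sum_mono)
      fix k assume k: "k \<in> I"
      let ?q = "(a k)\<^sup>2 + r * (b k)\<^sup>2"
      have "r * (\<bar>a k\<bar> / ?q) + r * \<bar>b k\<bar> / ?q = r * (\<bar>a k\<bar> + \<bar>b k\<bar>) / ?q"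
        by (simp add: add_divide_distrib distrib_left)
      also have "\<dots> \<le> 1 + r"
        using weighted_square_ge[OF norm[OF k], of r] weighted_square_pos[OF norm[OF k] that]
        by (simp add: norm[OF k] divide_le_eq)
      finally show "r * (\<bar>a k\<bar> / ?q) + r * \<bar>b k\<bar> / ?q \<le> 1 + r" .
    qed
    finally show ?thesis
      by (simp add: c_def)
  qed
  \<comment> \<open>The second property says that the slack covers the factor
    \<open>1 + 1 / R\<close> lost at the ends of \<open>{1/R..R}\<close>. The leading 1 in the
    witness keeps \<open>1 < R\<close> even if \<open>c * w = 0\<close>.\<close>
  obtain R where R: "1 < R" "w * c * (1 + R) \<le> R"
  proof
    show "1 < 1 + 1 / (1 - c * w)"
      using c by simp
    have "(1 - c * w) * (1 / (1 - c * w)) = 1"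
      using c by simp
    then have "w * c * (1 / (1 - c * w)) = 1 / (1 - c * w) - 1"
      by (simp only: left_diff_distrib mult_1 ac_simps)
    then show "w * c * (1 + (1 + 1 / (1 - c * w))) \<le> 1 + 1 / (1 - c * w)"
      using c unfolding distrib_left by (simp add: mult.commute)
  qed
  have "\<forall>r\<in>{1/R..R}. (a k)\<^sup>2 + r * (b k)\<^sup>2 \<noteq> 0" if "k \<in> I" for k
  proof
    fix r assume "r \<in> {1/R..R}"
    moreover have "0 < 1/R"
      using R(1) by simp
    ultimately have "0 < r"
      by (meson atLeastAtMost_iff order.strict_trans2)
    then show "(a k)\<^sup>2 + r * (b k)\<^sup>2 \<noteq> 0"
      using weighted_square_pos[OF norm[OF that], of r] by simp
  qed
  then have contF: "continuous_on {1/R..R} F" and contG: "continuous_on {1/R..R} G"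
    unfolding F_def G_def by (intro continuous_intros; assumption?; simp)+
  \<comment> \<open>In the first two cases the end point itself serves: the larger sum is bounded by
    dropping the smaller, nonnegative one from \<open>FG\<close>. In the third, \<open>G - F\<close>
    changes sign on the interval.\<close>
  consider "F (1/R) \<le> G (1/R)" | "G R \<le> F R" | "F R < G R" "G (1/R) < F (1/R)"
    by linarith
  then have "\<exists>r>0. w * F r \<le> 1 \<and> w * G r \<le> 1"
  proof cases
    case 1
    have "R * (1/R * F (1/R) + G (1/R)) \<le> R * (c * (1 + 1/R))"
      using FG[of "1/R"] R(1) by (intro mult_left_mono) auto
    then have "F (1/R) + R * G (1/R) \<le> c * (1 + R)"
      using R(1) by (simp add: algebra_simps)
    moreover have "0 \<le> F (1/R)"
      unfolding F_def using R(1) by (intro sum_nonneg) simp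
    ultimately have "R * G (1/R) \<le> c * (1 + R)"
      by linarith
    then have "w * (R * G (1/R)) \<le> w * (c * (1 + R))"
      using w(1) by (rule mult_left_mono)
    then have "R * (w * G (1/R)) \<le> R * 1"
      using R(2) by (simp add: ac_simps)
    then have "w * G (1/R) \<le> 1"
      using R(1) by simp
    moreover have "w * F (1/R) \<le> w * G (1/R)"
      using 1 w(1) by (rule mult_left_mono)
    ultimately show ?thesis
      using R(1) by (intro exI[of _ "1/R"]) auto
  next
    case 2
    have "0 \<le> G R"
      unfolding G_def using R(1) by (intro sum_nonneg) simp
    then have "R * F R \<le> c * (1 + R)"
      using FG[of R] R(1) by simp
    then have "w * (R * F R) \<le> w * (c * (1 + R))"
      using w(1) by (rule mult_left_mono)
    then have "R * (w * F R) \<le> R * 1"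
      using R(2) by (simp add: ac_simps)
    then have "w * F R \<le> 1"
      using R(1) by simp
    moreover have "w * G R \<le> w * F R"
      using 2 w(1) by (rule mult_left_mono)
    ultimately show ?thesis
      using R(1) by (intro exI[of _ R]) auto
  next
    case 3
    have "1 / R < 1"
      using R(1) by simp
    then have "1 / R \<le> R"
      using R(1) by linarith
    then obtain r where r: "1 / R \<le> r" "r \<le> R" "G r - F r = 0"
      using IVT'[of "\<lambda>r. G r - F r" "1/R" 0 R] 3 contF contG
      by (auto intro: continuous_on_diff)
    have "0 < 1 / R"
      using R(1) by simp
    then have r0: "0 < r"
      using r(1) by linarith
    \<comment> \<open>With \<open>F r = G r\<close> the weights \<open>r\<close> and 1 add up, and
      the factor \<open>1 + r\<close> cancels.\<close>
    have "(1 + r) * F r \<le> (1 + r) * c"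
      using FG[OF r0] r(3) by (simp add: algebra_simps)
    then have "F r \<le> c"
      using r0 by simp
    then have "w * F r \<le> 1"
      using c(2) mult_left_mono[OF _ w(1)] by (metis less_eq_real_def mult.commute order.trans)
    with r(3) r0 show ?thesis
      by auto
  qed
  with that show thesis
    unfolding F_def G_def by blast
qed

section \<open>The plank theorem for the square\<close>

lemma plank_square:
  fixes a b m :: "'i \<Rightarrow> real" and w :: real
  assumes "finite I"
    and norm: "\<And>k. k \<in> I \<Longrightarrow> \<bar>a k\<bar> + \<bar>b k\<bar> = 1"
    and w: "0 \<le> w" "real (card I) * w < 1"
  obtains x y where "\<bar>x\<bar> \<le> 1" "\<bar>y\<bar> \<le> 1"
    and "\<And>k. k \<in> I \<Longrightarrow> w \<le> \<bar>a k * x + b k * y - m k\<bar>"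
\<comment> \<open>The main argument divides by \<open>d k\<close>, which is positive only for
  positive \<open>w\<close>.\<close>
proof (cases "w = 0")
  case True
  with that[of 0 0] show thesis by auto
next
  case False
  with w have w0: "0 < w" by simp
  obtain r where r: "0 < r"
    and F: "w * (\<Sum>k\<in>I. \<bar>a k\<bar> / ((a k)\<^sup>2 + r * (b k)\<^sup>2)) \<le> 1"
    and G: "w * (\<Sum>k\<in>I. r * \<bar>b k\<bar> / ((a k)\<^sup>2 + r * (b k)\<^sup>2)) \<le> 1"
    using balanced_scaling[where I=I and a=a and b=b, OF norm w] by blast
  define d where "d = (\<lambda>k. w / ((a k)\<^sup>2 + r * (b k)\<^sup>2))"
  have d: "0 < d k" "d k * ((a k)\<^sup>2 + r * (b k)\<^sup>2) = w" if "k \<in> I" for k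
    using weighted_square_pos[OF norm[OF that] r] w0 by (auto simp: d_def)
  \<comment> \<open>In the coordinates \<open>(x, y / sqrt r)\<close> this is the vector
    \<open>d k * (a k, r * b k)\<close>. Its standard inner product with the signed sum is
    \<open>d k * (a k * x + b k * y)\<close>, and its squared norm is \<open>d k * w\<close>, so
    \<open>d k\<close> cancels from Bang's inequality with shifts \<open>d k * m k\<close>.\<close>
  define v where "v = (\<lambda>k. (d k * a k, sqrt r * (d k * b k)))"
  obtain \<epsilon> where \<epsilon>: "\<And>k. k \<in> I \<Longrightarrow> \<bar>\<epsilon> k\<bar> = 1"
    and bang: "\<And>k. k \<in> I \<Longrightarrow>
      (norm (v k))\<^sup>2 \<le> \<bar>v k \<bullet> (\<Sum>j\<in>I. \<epsilon> j *\<^sub>R v j) - d k * m k\<bar>"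
    using Bang_signs[OF \<open>finite I\<close>, of v "\<lambda>k. d k * m k"] by blast
  define x where "x = (\<Sum>j\<in>I. \<epsilon> j * (d j * a j))"
  define y where "y = (\<Sum>j\<in>I. \<epsilon> j * (r * (d j * b j)))"
  have S: "(\<Sum>j\<in>I. \<epsilon> j *\<^sub>R v j) = (x, \<Sum>j\<in>I. \<epsilon> j * (sqrt r * (d j * b j)))"
    by (simp add: v_def x_def prod_eq_iff fst_sum snd_sum)
  have y: "sqrt r * (\<Sum>j\<in>I. \<epsilon> j * (sqrt r * (d j * b j))) = y"
    unfolding y_def sum_distrib_left
  proof (rule sum.cong)
    fix j
    have "sqrt r * (\<epsilon> j * (sqrt r * (d j * b j))) = (sqrt r * sqrt r) * (\<epsilon> j * (d j * b j))"
      by (simp only: ac_simps)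
    then show "sqrt r * (\<epsilon> j * (sqrt r * (d j * b j))) = \<epsilon> j * (r * (d j * b j))"
      using r by simp
  qed simp
  show thesis
  proof
    have "\<bar>x\<bar> \<le> (\<Sum>j\<in>I. \<bar>\<epsilon> j * (d j * a j)\<bar>)"
      unfolding x_def by (rule sum_abs)
    also have "\<dots> = w * (\<Sum>k\<in>I. \<bar>a k\<bar> / ((a k)\<^sup>2 + r * (b k)\<^sup>2))"
      unfolding sum_distrib_left
      by (rule sum.cong) (use d(1) \<epsilon> in \<open>auto simp: abs_mult abs_of_pos\<close>, simp add: d_def)
    finally show "\<bar>x\<bar> \<le> 1"
      using F by simp
    have "\<bar>y\<bar> \<le> (\<Sum>j\<in>I. \<bar>\<epsilon> j * (r * (d j * b j))\<bar>)"
      unfolding y_def by (rule sum_abs)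
    also have "\<dots> = w * (\<Sum>k\<in>I. r * \<bar>b k\<bar> / ((a k)\<^sup>2 + r * (b k)\<^sup>2))"
      unfolding sum_distrib_left
      by (rule sum.cong) (use d(1) \<epsilon> r in \<open>auto simp: abs_mult abs_of_pos\<close>, simp add: d_def)
    finally show "\<bar>y\<bar> \<le> 1"
      using G by simp
  next
    fix k assume k: "k \<in> I"
    have "(norm (v k))\<^sup>2 = d k * (d k * ((a k)\<^sup>2 + r * (b k)\<^sup>2))"
      using r unfolding power2_norm_eq_inner v_def
      by (simp add: power2_eq_square algebra_simps)
    then have "(norm (v k))\<^sup>2 = d k * w"
      using d(2)[OF k] by simp
    moreover have "v k \<bullet> (\<Sum>j\<in>I. \<epsilon> j *\<^sub>R v j) - d k * m k = d k * (a k * x + b k * y - m k)"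
      unfolding S y[symmetric] by (simp add: v_def algebra_simps)
    ultimately have "d k * w \<le> d k * \<bar>a k * x + b k * y - m k\<bar>"
      using bang[OF k] d(1)[OF k] by (simp add: abs_mult)
    then show "w \<le> \<bar>a k * x + b k * y - m k\<bar>"
      using d(1)[OF k] by simp
  qed
qed

section \<open>Lines, cells and the lower bound\<close>

lemma line_normalized:
  assumes "line l"
  obtains a b m where "\<bar>a\<bar> + \<bar>b\<bar> = (1::real)" "\<And>p. p \<in> l \<Longrightarrow> a * fst p + b * snd p = m"
proof -
  have "\<exists>u c. u \<noteq> 0 \<and> affine hull l = {p. u \<bullet> p = c}"
    using assms unfolding aff_dim_eq_hyperplane[symmetric] by (simp add: line_def)
  moreover have "affine hull l = l"
    using assms by (simp add: line_def)
  ultimately obtain u c where u: "u \<noteq> 0" "l = {p. u \<bullet> p = c}"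
    by auto
  \<comment> \<open>Dividing by the 1-norm of the normal, dual to the sup-norm, turns the deviation
    from the line equation into sup-norm distance.\<close>
  define s where "s = \<bar>fst u\<bar> + \<bar>snd u\<bar>"
  have s: "0 < s"
    using u(1) by (auto simp: s_def prod_eq_iff zero_prod_def)
  show thesis
  proof
    show "\<bar>fst u / s\<bar> + \<bar>snd u / s\<bar> = 1"
      using s by (simp add: s_def flip: add_divide_distrib)
    show "fst u / s * fst p + snd u / s * snd p = c / s" if "p \<in> l" for p
      using that u(2) by (auto simp: inner_prod_def simp flip: add_divide_distrib)
  qed
qed

lemma subdivision_interval:
  fixes x :: real
  assumes "1 \<le> n" "\<bar>x\<bar> \<le> 1"
  obtains i where "i \<in> {1..n}"
    "x \<in> {-1 + (real i - 1) * (2 / real n) .. -1 + real i * (2 / real n)}"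
proof -
  \<comment> \<open>The distance of \<open>x\<close> from the left end -1, in units of the cell
    side.\<close>
  define t where "t = (x + 1) * real n / 2"
  have n: "0 < real n"
    using assms(1) by simp
  have "0 \<le> t" "t \<le> real n"
    using assms n mult_right_mono[of "x + 1" 2 "real n"] by (auto simp: t_def abs_le_iff)
  then have "\<exists>i\<in>{1..n}. real i - 1 \<le> t \<and> t \<le> real i"
  \<comment> \<open>The rounded-up \<open>t\<close> is the index, except that at the left end it
    would be 0, outside \<open>{1..n}\<close>.\<close>
  proof (cases "t = 0")
    case True
    with assms(1) show ?thesis by (intro bexI[of _ 1]) auto
  next
    case False
    with \<open>0 \<le> t\<close> \<open>t \<le> real n\<close> show ?thesis
      by (intro bexI[of _ "nat \<lceil>t\<rceil>"]) (auto simp: nat_le_iff ceiling_le_iff Suc_le_eq, linarith?)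
  qed
  then obtain i where i: "i \<in> {1..n}" "real i - 1 \<le> t" "t \<le> real i"
    by blast
  have "x = -1 + t * (2 / real n)"
    using n by (simp add: t_def)
  moreover have "(real i - 1) * (2 / real n) \<le> t * (2 / real n)"
    "t * (2 / real n) \<le> real i * (2 / real n)"
    using i(2,3) n by (intro mult_right_mono; simp)+
  ultimately show thesis
    using i(1) that[of i] by simp
qed

lemma card_lines_ge:
  assumes "n \<ge> 1" "finite L" "\<forall>l\<in>L. line l" "hits_board n L"
  shows "n \<le> 2 * card L"
proof (rule ccontr)
  assume "\<not> n \<le> 2 * card L"
  then have "2 * card L + 1 \<le> n"
    by simp
  then have card: "2 * real (card L) + 1 \<le> real n"
    by linarith
  \<comment> \<open>The denominator lies strictly between \<open>2 * card L\<close> and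
    \<open>n\<close>. Strictness against \<open>n\<close> matters because a line may meet a closed
    cell at distance exactly \<open>2 / real n\<close> from a point of it.\<close>
  define w where "w = 2 / (real n - 1/2)"
  have "2 / real n < w"
    unfolding w_def using card by (intro divide_strict_left_mono) auto
  moreover have "0 \<le> w" "real (card L) * w < 1"
    using card assms(1) by (simp_all add: w_def)
  ultimately have w: "0 \<le> w" "2 / real n < w" "real (card L) * w < 1"
    by simp_all
  have "\<forall>l\<in>L. \<exists>a b m. \<bar>a\<bar> + \<bar>b\<bar> = (1::real) \<and> (\<forall>p\<in>l. a * fst p + b * snd p = m)"
  proof
    fix l assume "l \<in> L"
    with assms(3) have "line l"
      by simp
    then obtain a b m where "\<bar>a\<bar> + \<bar>b\<bar> = (1::real)" "\<And>p. p \<in> l \<Longrightarrow> a * fst p + b * snd p = m"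
      using line_normalized by metis
    then show "\<exists>a b m. \<bar>a\<bar> + \<bar>b\<bar> = (1::real) \<and> (\<forall>p\<in>l. a * fst p + b * snd p = m)"
      by (intro exI[of _ a] exI[of _ b] exI[of _ m]) simp
  qed
  then obtain a b m where norm: "\<And>l. l \<in> L \<Longrightarrow> \<bar>a l\<bar> + \<bar>b l\<bar> = (1::real)"
    and eq: "\<And>l p. l \<in> L \<Longrightarrow> p \<in> l \<Longrightarrow> a l * fst p + b l * snd p = m l"
    unfolding bchoice_iff by blast
  obtain x y where xy: "\<bar>x\<bar> \<le> 1" "\<bar>y\<bar> \<le> 1"
    and far: "\<And>l. l \<in> L \<Longrightarrow> w \<le> \<bar>a l * x + b l * y - m l\<bar>"
    using plank_square[where a=a and b=b and m=m, OF \<open>finite L\<close> norm w(1,3)] by blast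
  obtain i where i: "i \<in> {1..n}"
    "x \<in> {-1 + (real i - 1) * (2 / real n) .. -1 + real i * (2 / real n)}"
    using subdivision_interval[OF assms(1) xy(1)] .
  obtain j where j: "j \<in> {1..n}"
    "y \<in> {-1 + (real j - 1) * (2 / real n) .. -1 + real j * (2 / real n)}"
    using subdivision_interval[OF assms(1) xy(2)] .
  obtain l p where l: "l \<in> L" "p \<in> l" "p \<in> cell n i j"
    using assms(4) i(1) j(1) unfolding hits_board_def hits_def by blast
  have dist: "\<bar>x - fst p\<bar> \<le> 2 / real n" "\<bar>y - snd p\<bar> \<le> 2 / real n"
    using l(3) i(2) j(2)
    unfolding cell_def mem_Times_iff atLeastAtMost_iff left_diff_distrib mult_1 abs_le_iff
    by linarith+
  have "\<bar>a l * x + b l * y - m l\<bar> = \<bar>a l * (x - fst p) + b l * (y - snd p)\<bar>"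
    using eq[OF l(1,2)] by (simp add: algebra_simps)
  also have "\<dots> \<le> \<bar>a l\<bar> * \<bar>x - fst p\<bar> + \<bar>b l\<bar> * \<bar>y - snd p\<bar>"
    unfolding abs_mult[symmetric] by (rule abs_triangle_ineq)
  also have "\<dots> \<le> \<bar>a l\<bar> * (2 / real n) + \<bar>b l\<bar> * (2 / real n)"
    using dist by (intro add_mono mult_left_mono) auto
  also have "\<dots> = 2 / real n"
    by (simp only: norm[OF l(1)] mult_1 flip: distrib_right)
  finally show False
    using far[OF l(1)] w(2) by simp
qed

section \<open>Horizontal lines for the upper bound\<close>

lemma line_horizontal: "line {p. snd p = c}"
proof -
  have "{p::real \<times> real. snd p = c} = {p. (0, 1) \<bullet> p = c}"
    by (auto simp: inner_prod_def)
  then show ?thesis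
    unfolding line_def using affine_hyperplane[of "(0::real, 1::real)" c]
      aff_dim_hyperplane[of "(0::real, 1::real)" c]
    by (simp add: zero_prod_def)
qed

lemma half_lines_hit_board:
  assumes "n \<ge> 1"
  obtains L where "finite L" "card L = (n + 1) div 2" "\<forall>l\<in>L. line l" "hits_board n L"
proof -
  \<comment> \<open>The height is the common edge of rows \<open>2 * k - 1\<close> and
    \<open>2 * k\<close>, which belongs to both since cells are closed. For odd \<open>n\<close> the
    last line is the top edge of the board.\<close>
  define f where "f = (\<lambda>k::nat. {p::real \<times> real. snd p = -1 + (2 * real k - 1) * (2 / real n)})"
  have n: "0 < real n"
    using assms by simp
  have "inj f"
  proof (rule injI)
    fix k k' assume "f k = f k'"
    moreover have "(0, -1 + (2 * real k - 1) * (2 / real n)) \<in> f k"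
      by (simp add: f_def)
    ultimately have "(0, -1 + (2 * real k - 1) * (2 / real n)) \<in> f k'"
      by simp
    then show "k = k'"
      using n by (simp add: f_def)
  qed
  show thesis
  proof
    show "finite (f ` {1..(n + 1) div 2})" "card (f ` {1..(n + 1) div 2}) = (n + 1) div 2"
      using \<open>inj f\<close> by (auto simp: card_image inj_on_def inj_def)
    show "\<forall>l\<in>f ` {1..(n + 1) div 2}. line l"
      by (auto simp: f_def line_horizontal)
    show "hits_board n (f ` {1..(n + 1) div 2})"
      unfolding hits_board_def
    proof (intro ballI)
      fix i j assume ij: "i \<in> {1..n}" "j \<in> {1..n}"
      define k where "k = (j + 1) div 2"
      have k: "k \<in> {1..(n + 1) div 2}"
        using ij by (auto simp: k_def)
      have "j \<le> 2 * k" "2 * k \<le> j + 1"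
        by (auto simp: k_def)
      then have "real j - 1 \<le> 2 * real k - 1" "2 * real k - 1 \<le> real j"
        by linarith+
      then have "(real j - 1) * (2 / real n) \<le> (2 * real k - 1) * (2 / real n)"
        "(2 * real k - 1) * (2 / real n) \<le> real j * (2 / real n)"
        using n by (auto intro!: mult_right_mono divide_right_mono)
      moreover have "(real i - 1) * (2 / real n) \<le> real i * (2 / real n)"
        using n by (auto intro!: mult_right_mono divide_right_mono)
      ultimately have "(-1 + real i * (2 / real n), -1 + (2 * real k - 1) * (2 / real n))
          \<in> f k \<inter> cell n i j"
        by (auto simp: f_def cell_def)
      with k show "\<exists>l\<in>f ` {1..(n + 1) div 2}. hits l (cell n i j)"
        unfolding hits_def by blast
    qed
  qed
qed

theorem theorem1:
  fixes n :: nat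
  assumes "n \<ge> 1"
  shows "int (h n) = \<lceil>real n / 2\<rceil>"
proof -
  have "h n = (n + 1) div 2"
    unfolding h_def
  proof (rule Least_equality)
    show "\<exists>L. finite L \<and> card L = (n + 1) div 2 \<and> (\<forall>l\<in>L. line l) \<and> hits_board n L"
      using half_lines_hit_board[OF assms] by blast
  next
    fix k assume "\<exists>L. finite L \<and> card L = k \<and> (\<forall>l\<in>L. line l) \<and> hits_board n L"
    then have "n \<le> 2 * k"
      using card_lines_ge[OF assms] by blast
    then show "(n + 1) div 2 \<le> k"
      by simp
  qed
  moreover have "\<lceil>real n / 2\<rceil> = int ((n + 1) div 2)"
    by (cases "even n") (auto elim!: evenE oddE intro!: ceiling_unique)
  ultimately show ?thesis
    by simp
qed

end
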